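(* Let $R$ be a finite non-commutative ring, let $S$ and $K$ be two subrings of $R$, and let $p$ be the smallest prime dividing $|R|$. Put $X_S = \{s\in S : C_K(s)=\{0\}\}$ and $X_K = \{k\in K : C_S(k)=\{0\}\}$. Then \[ \Pr(S,K)\geq \frac{|Z(S,K)|}{|S|}+\frac{p(|S|-|X_S|-|Z(S,K)|)+|X_S|}{|S||K|} \] and \[ \Pr(S,K)\leq \frac{(p-1)|Z(S,K)|+|S|}{p|S|}-\frac{|X_S|(|K|-p)}{p|S||K|}. \] Moreover, in each of these bounds $S$ and $K$ can be interchanged, that is, \[ \Pr(S,K)\geq \frac{|Z(K,S)|}{|K|}+\frac{p(|K|-|X_K|-|Z(K,S)|)+|X_K|}{|S||K|} \] and \[ \Pr(S,K)\leq \frac{(p-1)|Z(K,S)|+|K|}{p|K|}-\frac{|X_K|(|S|-p)}{p|S||K|}. \]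
   Context: Rings are associative and need not have an identity; a subring is an additive subgroup closed under multiplication. For subrings $S,K$ of $R$, $\Pr(S,K) := \frac{|\{(s,k)\in S\times K : sk=ks\}|}{|S\times K|}$, $Z(S,K) := \{s\in S : sk=ks \text{ for all } k\in K\}$ (so $Z(K,S) = \{k\in K : ks=sk \text{ for all } s\in S\}$), and for $x\in R$, $C_K(x) := \{k\in K : kx=xk\}$ and $C_S(x) := \{s\in S : sx=xs\}$. *)

theory Defs
  imports Complex_Main "HOL-Computational_Algebra.Primes"
begin

text \<open>
  The ambient ring is a type of class \<open>ring\<close>, which is associative and does not
  assume a multiplicative identity. Subrings are likewise not required to be unital.
\<close>

definition is_subring :: "'a::ring set \<Rightarrow> bool" where
  "is_subring S \<longleftrightarrow>
     0 \<in> S \<and> (\<forall>x\<in>S. \<forall>y\<in>S. x + y \<in> S) \<and> (\<forall>x\<in>S. - x \<in> S) \<and> (\<forall>x\<in>S. \<forall>y\<in>S. x * y \<in> S)"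

definition commuting_prob :: "'a::ring set \<Rightarrow> 'a set \<Rightarrow> real" where
  "commuting_prob S K =
     real (card {(s, k). (s, k) \<in> S \<times> K \<and> s * k = k * s}) / real (card (S \<times> K))"

definition rel_center :: "'a::ring set \<Rightarrow> 'a set \<Rightarrow> 'a set" where
  "rel_center S K = {s \<in> S. \<forall>k\<in>K. s * k = k * s}"

definition centralizer_in :: "'a::ring set \<Rightarrow> 'a \<Rightarrow> 'a set" where
  "centralizer_in K x = {k \<in> K. k * x = x * k}"

text \<open>\<open>trivial_centralizer_set S K\<close> is $X_S$ and \<open>trivial_centralizer_set K S\<close> is $X_K$.\<close>

definition trivial_centralizer_set :: "'a::ring set \<Rightarrow> 'a set \<Rightarrow> 'a set" where
  "trivial_centralizer_set S K = {s \<in> S. centralizer_in K s = {0}}"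

end

theory Submission
  imports Defs
begin

text \<open>
  Summing over \<open>s \<in> S\<close>, the number of commuting pairs is the sum of all \<open>|C\<^sub>K(s)|\<close>. Here
  \<open>C\<^sub>K(s)\<close> equals \<open>K\<close> for \<open>s \<in> Z(S,K)\<close> and \<open>{0}\<close> for \<open>s \<in> X\<^sub>S\<close>. For every other \<open>s\<close> it is a
  nontrivial proper additive subgroup of \<open>K\<close>, so by Lagrange both its order and its index are
  divisors of \<open>|R|\<close> greater than 1, hence at least \<open>p\<close>. The bounds with \<open>S\<close> and \<open>K\<close>
  interchanged follow from \<open>Pr(S,K) = Pr(K,S)\<close>.
\<close>

text \<open>The one-step subgroup criterion: negatives and sums are recovered from differences when
  cosets are formed. The notion covers the whole ring, its subrings and the centralizers alike, so
  one form of Lagrange's theorem serves all of them.\<close>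

definition additive_subgroup :: "'a::ab_group_add set \<Rightarrow> bool" where
  "additive_subgroup A \<longleftrightarrow> 0 \<in> A \<and> (\<forall>x\<in>A. \<forall>y\<in>A. x - y \<in> A)"

lemma additive_subgroup_UNIV: "additive_subgroup UNIV"
  by (simp add: additive_subgroup_def)

lemma additive_subgroup_subring:
  assumes "is_subring S"
  shows "additive_subgroup S"
  unfolding additive_subgroup_def
proof (intro conjI ballI)
  show "0 \<in> S"
    using assms by (simp add: is_subring_def)
  fix x y assume "x \<in> S" "y \<in> S"
  with assms have "x + - y \<in> S"
    unfolding is_subring_def by blast
  then show "x - y \<in> S" by simp
qed

lemma additive_subgroup_centralizer_in:
  assumes "additive_subgroup K"
  shows "additive_subgroup (centralizer_in K x)"
  using assms by (auto simp: additive_subgroup_def centralizer_in_def algebra_simps)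

text \<open>Lagrange's theorem. The classes of \<open>?r\<close> are the cosets
  \<open>b + A\<close>, each in bijection with \<open>A\<close> by translation, and they partition
  \<open>B\<close>.\<close>

lemma additive_subgroup_card_dvd:
  fixes A B :: "'a::ab_group_add set"
  assumes A: "additive_subgroup A" and B: "additive_subgroup B" and "A \<subseteq> B" and "finite B"
  shows "card A dvd card B"
proof -
  let ?r = "{(x, y). x \<in> B \<and> y \<in> B \<and> y - x \<in> A}"
  have A_minus: "- x \<in> A" if "x \<in> A" for x
    using A that unfolding additive_subgroup_def by (metis diff_0)
  have A_add: "x + y \<in> A" if "x \<in> A" "y \<in> A" for x y
    using A that A_minus[of y] unfolding additive_subgroup_def by (metis diff_minus_eq_add)
  have B_add: "x + y \<in> B" if "x \<in> B" "y \<in> A" for x y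
    using B that A_minus[of y] \<open>A \<subseteq> B\<close> unfolding additive_subgroup_def
    by (metis diff_minus_eq_add subsetD)
  have "equiv B ?r"
  proof (rule equivI)
    show "refl_on B ?r"
      using A by (auto simp: refl_on_def additive_subgroup_def)
    show "sym ?r"
      using A_minus by (fastforce simp: sym_def)
    show "trans ?r"
    proof (rule transI)
      fix x y z assume "(x, y) \<in> ?r" "(y, z) \<in> ?r"
      then show "(x, z) \<in> ?r"
        using A_add[of "z - y" "y - x"] by simp
    qed
  qed auto
  moreover have "card A dvd card X" if X: "X \<in> B // ?r" for X
  proof -
    from X obtain b where b: "b \<in> B" and X_eq: "X = ?r `` {b}"
      by (rule quotientE)
    have "X = (+) b ` A"
    proof
      show "X \<subseteq> (+) b ` A"
      proof
        fix y assume "y \<in> X"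
        then have "y - b \<in> A" by (simp add: X_eq)
        then show "y \<in> (+) b ` A" by (metis diff_add_cancel add.commute image_eqI)
      qed
      show "(+) b ` A \<subseteq> X"
        using b B_add by (auto simp: X_eq)
    qed
    then show ?thesis by (simp add: card_image)
  qed
  ultimately show ?thesis
    using \<open>finite B\<close> by (blast intro: equiv_imp_dvd_card)
qed

text \<open>A prime factor \<open>q\<close> of \<open>d\<close> also divides \<open>n\<close>, so
  \<open>p \<le> q\<close>. Since \<open>n > 0\<close> excludes \<open>d = 0\<close>, also
  \<open>q \<le> d\<close>.\<close>

lemma least_prime_le_dvd:
  fixes p d n :: nat
  assumes "\<And>q. prime q \<Longrightarrow> q dvd n \<Longrightarrow> p \<le> q" and "d dvd n" "n > 0" "d \<noteq> 1"
  shows "p \<le> d"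
proof -
  obtain q where "prime q" "q dvd d"
    using prime_factor_nat[OF \<open>d \<noteq> 1\<close>] by blast
  moreover have "d > 0"
    using assms by (meson dvd_pos_nat)
  ultimately show ?thesis
    using assms by (meson dvd_imp_le dvd_trans le_trans)
qed

lemma card_commuting_pairs:
  fixes S K :: "'a::{ring, finite} set"
  shows "card {(s, k). (s, k) \<in> S \<times> K \<and> s * k = k * s} = (\<Sum>s\<in>S. card (centralizer_in K s))"
proof -
  have "{(s, k). (s, k) \<in> S \<times> K \<and> s * k = k * s} = Sigma S (centralizer_in K)"
    by (auto simp: centralizer_in_def)
  then show ?thesis by simp
qed

lemma commuting_prob_commute:
  fixes S K :: "'a::{ring, finite} set"
  shows "commuting_prob S K = commuting_prob K S"
proof -
  have "card {(s, k). (s, k) \<in> S \<times> K \<and> s * k = k * s}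
      = card {(k, s). (k, s) \<in> K \<times> S \<and> k * s = s * k}"
    by (rule bij_betw_same_card[of prod.swap])
      (auto simp: bij_betw_def inj_on_def image_iff)
  then show ?thesis
    by (simp add: commuting_prob_def card_cartesian_product mult.commute)
qed

text \<open>One of the two symmetric pairs of bounds; the theorem instantiates it at
  \<open>S K\<close> and at \<open>K S\<close>.\<close>

lemma commuting_prob_bounds:
  fixes S K :: "'a::{ring, finite} set" and p :: nat
  assumes S: "is_subring S" and K: "is_subring K" and p: "prime p"
    and p_least: "\<And>q :: nat. prime q \<Longrightarrow> q dvd card (UNIV :: 'a set) \<Longrightarrow> p \<le> q"
  defines "X \<equiv> trivial_centralizer_set S K" and "Z \<equiv> rel_center S K"
  shows "real (card Z) / real (card S)
      + (real p * (real (card S) - real (card X) - real (card Z)) + real (card X))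
        / (real (card S) * real (card K)) \<le> commuting_prob S K"
    and "commuting_prob S K \<le>
      ((real p - 1) * real (card Z) + real (card S)) / (real p * real (card S))
      - (real (card X) * (real (card K) - real p)) / (real p * real (card S) * real (card K))"
proof -
  let ?c = "\<lambda>s. real (card (centralizer_in K s))"
  define N where "N = (\<Sum>s\<in>S. ?c s)"
  have addK: "additive_subgroup K"
    using K by (rule additive_subgroup_subring)
  have p1: "real p > 1"
    using prime_gt_1_nat[OF p] by simp
  have ne: "S \<noteq> {}" "K \<noteq> {}"
    using S K by (auto simp: is_subring_def)
  then have pos: "real (card S) > 0" "real (card K) > 0"
    by (simp_all add: card_gt_0_iff)
  have prob: "commuting_prob S K = N / (real (card S) * real (card K))"
    by (simp only: commuting_prob_def card_commuting_pairs card_cartesian_product N_def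
        of_nat_sum of_nat_mult)
  have cZ: "?c s = real (card K)" if "s \<in> Z" for s
  proof -
    have "centralizer_in K s = K"
      using that by (auto simp: Z_def rel_center_def centralizer_in_def)
    then show ?thesis by simp
  qed
  have cX: "?c s = 1" if "s \<in> X" for s
    using that by (simp add: X_def trivial_centralizer_set_def)
  \<comment> \<open>Both bounds with denominators cleared: the lower one multiplied by |S||K|, the
    upper one by p|S||K|.\<close>
  have "real (card Z) * real (card K) + real p * (real (card S) - real (card X) - real (card Z))
        + real (card X) \<le> N
    \<and> real p * N \<le> real p * (real (card Z) * real (card K) + real (card X))
        + (real (card S) - real (card X) - real (card Z)) * real (card K)"
  proof (cases "K = {0}")
    text \<open>Here \<open>X = Z = S\<close>, so \<open>S\<close> does not split as in the other case.\<close>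
    case True
    then have "centralizer_in K s = {0}" for s
      by (auto simp: centralizer_in_def)
    then have "X = S" "Z = S" "N = real (card S)"
      using True
      by (auto simp: X_def Z_def N_def trivial_centralizer_set_def rel_center_def)
    \<comment> \<open>With \<open>card K = 1\<close> and \<open>X\<close>, \<open>Z\<close>,
      \<open>N\<close> as just found, both inequalities reduce to this one.\<close>
    moreover have "real (card S) \<le> real p * real (card S)"
      using p1 pos by simp
    ultimately show ?thesis
      using True by (simp add: algebra_simps)
  next
    case False
    define W where "W = S - X - Z"
    \<comment> \<open>A common element would have a centralizer equal to both \<open>K\<close> and
      \<open>{0}\<close>, against \<open>K \<noteq> {0}\<close>.\<close>
    have disj: "X \<inter> Z = {}"
    proof -
      have "centralizer_in K s = K" if "s \<in> Z" for s
        using that by (auto simp: Z_def rel_center_def centralizer_in_def)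
      then show ?thesis
        using False by (auto simp: X_def trivial_centralizer_set_def)
    qed
    have S_eq: "S = Z \<union> X \<union> W" and disjW: "(Z \<union> X) \<inter> W = {}"
      by (auto simp: W_def X_def Z_def trivial_centralizer_set_def rel_center_def)
    have cardW: "real (card S) - real (card X) - real (card Z) = real (card W)"
      using disj disjW by (subst S_eq) (simp add: card_Un_disjoint Int_commute)
    have "N = (\<Sum>s\<in>Z. ?c s) + (\<Sum>s\<in>X. ?c s) + (\<Sum>s\<in>W. ?c s)"
      unfolding N_def using disj disjW
      by (subst S_eq) (simp add: sum.union_disjoint Int_commute)
    then have N: "N = real (card Z) * real (card K) + real (card X) + (\<Sum>s\<in>W. ?c s)"
      using cZ cX by simp
    have W_bounds: "real p \<le> ?c s \<and> real p * ?c s \<le> real (card K)" if s: "s \<in> W" for s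
    proof -
      let ?C = "centralizer_in K s"
      have sub: "?C \<subseteq> K" and add: "additive_subgroup ?C"
        using additive_subgroup_centralizer_in[OF addK] by (auto simp: centralizer_in_def)
      have "0 \<in> ?C"
        using add by (simp add: additive_subgroup_def)
      have neq: "?C \<noteq> {0}" "?C \<noteq> K"
      proof -
        have "s \<in> S" "s \<notin> X" "s \<notin> Z"
          using s by (auto simp: W_def)
        then obtain k where "k \<in> K" "k * s \<noteq> s * k"
          unfolding Z_def rel_center_def by force
        then have "k \<in> K" "k \<notin> ?C"
          by (simp_all add: centralizer_in_def)
        then show "?C \<noteq> K"
          by metis
        show "?C \<noteq> {0}"
          using \<open>s \<in> S\<close> \<open>s \<notin> X\<close> by (simp add: X_def trivial_centralizer_set_def)
      qed
      have K_dvd: "card K dvd card (UNIV :: 'a set)"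
        using addK additive_subgroup_UNIV by (rule additive_subgroup_card_dvd) auto
      \<comment> \<open>\<open>m\<close> is the index of \<open>?C\<close> in \<open>K\<close>. Both
        factors of \<open>card K\<close> divide the order of the ring, and neither is 1 because
        \<open>?C\<close> is nontrivial and proper. So \<open>p \<le> card ?C\<close> gives the
        first bound, and \<open>p \<le> m\<close> multiplied by \<open>card ?C\<close> gives the
        second.\<close>
      obtain m where m: "card K = card ?C * m"
        using additive_subgroup_card_dvd[OF add addK sub finite] by blast
      have "card ?C \<noteq> 1"
        using neq(1) \<open>0 \<in> ?C\<close> by (metis card_1_singletonE singletonD)
      moreover have "card ?C dvd card (UNIV :: 'a set)" "m dvd card (UNIV :: 'a set)"
        using K_dvd unfolding m by (blast dest: dvd_mult_left dvd_mult_right)+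
      moreover have "m \<noteq> 1"
        using neq(2) m sub by (metis card_subset_eq finite mult.right_neutral)
      moreover have "card (UNIV :: 'a set) > 0"
        by (simp add: card_gt_0_iff)
      ultimately have "p \<le> card ?C" "p \<le> m"
        using p_least least_prime_le_dvd by blast+
      then have "p \<le> card ?C \<and> p * card ?C \<le> card K"
        by (simp add: m mult.commute)
      then show ?thesis
        by (metis of_nat_le_iff of_nat_mult)
    qed
    \<comment> \<open>Summing the two halves of \<open>W_bounds\<close> over \<open>W\<close>
      estimates the only undetermined term of \<open>N\<close> from below and from above.\<close>
    have "real p * real (card W) \<le> (\<Sum>s\<in>W. ?c s)"
      using sum_mono[of W "\<lambda>_. real p" ?c] W_bounds by (simp add: mult.commute)
    moreover have "real p * (\<Sum>s\<in>W. ?c s) \<le> real (card W) * real (card K)"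
      unfolding sum_distrib_left
      using sum_mono[of W "\<lambda>s. real p * ?c s" "\<lambda>_. real (card K)"] W_bounds by simp
    ultimately show ?thesis
      unfolding cardW N by (simp add: algebra_simps)
  qed
  then have lower: "real (card Z) * real (card K)
        + real p * (real (card S) - real (card X) - real (card Z)) + real (card X) \<le> N"
    and upper: "real p * N \<le> real p * (real (card Z) * real (card K) + real (card X))
        + (real (card S) - real (card X) - real (card Z)) * real (card K)"
    by blast+
  have "real (card Z) / real (card S)
      + (real p * (real (card S) - real (card X) - real (card Z)) + real (card X))
        / (real (card S) * real (card K))
    = (real (card Z) * real (card K)
        + real p * (real (card S) - real (card X) - real (card Z)) + real (card X))
        / (real (card S) * real (card K))"
    using ne by (simp add: field_simps)
  also have "\<dots> \<le> commuting_prob S K"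
    unfolding prob using lower pos by (intro divide_right_mono) auto
  finally show "real (card Z) / real (card S)
      + (real p * (real (card S) - real (card X) - real (card Z)) + real (card X))
        / (real (card S) * real (card K)) \<le> commuting_prob S K" .
  \<comment> \<open>The fraction is expanded by \<open>p\<close> so that \<open>upper\<close>
    applies to its numerator.\<close>
  have "commuting_prob S K = (real p * N) / (real p * real (card S) * real (card K))"
    unfolding prob using p1 by simp
  also have "\<dots> \<le> (real p * (real (card Z) * real (card K) + real (card X))
        + (real (card S) - real (card X) - real (card Z)) * real (card K))
        / (real p * real (card S) * real (card K))"
    using upper pos by (intro divide_right_mono) auto
  \<comment> \<open>In the numerator the terms in \<open>Z\<close> and \<open>S\<close> collect to
    ((p - 1)|Z| + |S|)|K|, where |K| cancels, and those in \<open>X\<close> to -|X|(|K| -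
    p).\<close>
  also have "\<dots> = ((real p - 1) * real (card Z) + real (card S)) / (real p * real (card S))
      - (real (card X) * (real (card K) - real p)) / (real p * real (card S) * real (card K))"
    using ne p1 by (simp add: field_simps)
  finally show "commuting_prob S K \<le>
      ((real p - 1) * real (card Z) + real (card S)) / (real p * real (card S))
      - (real (card X) * (real (card K) - real p)) / (real p * real (card S) * real (card K))" .
qed

theorem theorem3p8:
  fixes S K :: "'a::{ring, finite} set" and p :: nat
  assumes noncomm: "\<exists>x y :: 'a. x * y \<noteq> y * x"
    and S: "is_subring S"
    and K: "is_subring K"
    and p: "prime p" "p dvd card (UNIV :: 'a set)"
    and p_least: "\<And>q :: nat. prime q \<Longrightarrow> q dvd card (UNIV :: 'a set) \<Longrightarrow> p \<le> q"
  defines "X\<^sub>S \<equiv> trivial_centralizer_set S K"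
    and "X\<^sub>K \<equiv> trivial_centralizer_set K S"
  shows "commuting_prob S K \<ge>
      real (card (rel_center S K)) / real (card S)
      + (real p * (real (card S) - real (card X\<^sub>S) - real (card (rel_center S K))) + real (card X\<^sub>S))
        / (real (card S) * real (card K))
    \<and> commuting_prob S K \<le>
      ((real p - 1) * real (card (rel_center S K)) + real (card S)) / (real p * real (card S))
      - (real (card X\<^sub>S) * (real (card K) - real p)) / (real p * real (card S) * real (card K))
    \<and> commuting_prob S K \<ge>
      real (card (rel_center K S)) / real (card K)
      + (real p * (real (card K) - real (card X\<^sub>K) - real (card (rel_center K S))) + real (card X\<^sub>K))
        / (real (card S) * real (card K))
    \<and> commuting_prob S K \<le>
      ((real p - 1) * real (card (rel_center K S)) + real (card K)) / (real p * real (card K))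
      - (real (card X\<^sub>K) * (real (card S) - real p)) / (real p * real (card S) * real (card K))"
proof -
  \<comment> \<open>Exchanging the subrings also reverses the factors in the denominators; these
    equations restore the order used in the statement.\<close>
  have comm: "real (card K) * real (card S) = real (card S) * real (card K)"
    "real p * real (card K) * real (card S) = real p * real (card S) * real (card K)"
    by simp_all
  note SK = commuting_prob_bounds[OF S K p(1) p_least]
  note KS = commuting_prob_bounds[OF K S p(1) p_least,
      unfolded commuting_prob_commute[of K S] comm]
  show ?thesis
    unfolding X\<^sub>S_def X\<^sub>K_def by (intro conjI SK KS)
qed

end
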